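(* Let $(X,\|\cdot\|)$ be a two-dimensional real normed space. The norm $\|\cdot\|$ is not Euclidean if and only if there exists some $x\in X$, $x\neq 0$, such that for each $\lambda\in(0,+\infty)\setminus\{1\}$ there exists $y\in X$ with $\|y\|=\lambda\|x\|$, $\langle x,y\rangle=X$ (i.e. $x,y$ are linearly independent), and $B(-x,x)\cap B(-y,y)\neq\{0\}$.
   Context: A norm is Euclidean if it is induced by an inner product. For $u,v\in X$, the bisector of $u$ and $v$ is $B(u,v)=\{w\in X:\|u-w\|=\|v-w\|\}$. $\langle x,y\rangle$ denotes the linear span of $x,y$. *)

theory Defs
  imports "HOL-Analysis.Analysis"
begin

definition norm_is_euclidean :: "('a::real_normed_vector) itself \<Rightarrow> bool" where
  "norm_is_euclidean _ \<longleftrightarrow>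
     (\<exists>ip :: 'a \<Rightarrow> 'a \<Rightarrow> real. bilinear ip \<and> (\<forall>x y. ip x y = ip y x)
        \<and> (\<forall>x. x \<noteq> 0 \<longrightarrow> ip x x > 0) \<and> (\<forall>x. norm x = sqrt (ip x x)))"

definition bisector :: "'a::real_normed_vector \<Rightarrow> 'a \<Rightarrow> 'a set" where
  "bisector u v = {w. norm (u - w) = norm (v - w)}"

end

theory Submission
  imports Defs
begin

text \<open>
  Write \<open>B(x)\<close> for the bisector of \<open>- x\<close> and \<open>x\<close>.  If \<open>x\<close> violates the condition for \<open>l \<noteq> 1\<close>,
  then every \<open>w \<in> B(x)\<close> lies in \<open>B(l x)\<close>, because some \<open>y\<close> of norm \<open>l \<parallel>x\<parallel>\<close> satisfies \<open>w \<in> B(y)\<close>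
  and \<open>y\<close> must be \<open>\<plusminus> l x\<close>.  When the unit circle contains no segment parallel to \<open>x\<close>, this self-similarity
  forces \<open>B(x)\<close> to be a line, so that the linear reflection \<open>x \<mapsto> - x\<close> fixing that line is an
  isometry.  Only countably many directions are parallel to a segment of the unit circle, so if every
  \<open>x\<close> violates the condition then there are reflections in a dense set of directions.  A linear
  isometry of determinant 1 has trace at most 2, hence one of determinant -1 has trace 0; applied to
  products of three reflections this shows that all of them preserve a common inner product.  The
  norm is then constant on a dense subset of a Euclidean circle.
\<close>

section \<open>Bases and coordinates in a two-dimensional space\<close>

definition plane_basis :: "'a::real_vector \<Rightarrow> 'a \<Rightarrow> bool" where
  "plane_basis u v \<longleftrightarrow>
     (\<forall>z. \<exists>s t. z = s *\<^sub>R u + t *\<^sub>R v) \<and>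
     (\<forall>s t. s *\<^sub>R u + t *\<^sub>R v = 0 \<longrightarrow> s = 0 \<and> t = 0)"

lemma plane_basis_ex:
  assumes "plane_basis u v"
  obtains s t where "z = s *\<^sub>R u + t *\<^sub>R v"
  using assms unfolding plane_basis_def by blast

lemma plane_basis_zeroD:
  assumes "plane_basis u v" "s *\<^sub>R u + t *\<^sub>R v = 0"
  shows "s = 0" "t = 0"
  using assms unfolding plane_basis_def by blast+

lemma plane_basis_eqD:
  assumes "plane_basis u v" "s *\<^sub>R u + t *\<^sub>R v = s' *\<^sub>R u + t' *\<^sub>R v"
  shows "s = s'" "t = t'"
proof -
  have "(s - s') *\<^sub>R u + (t - t') *\<^sub>R v = 0"
    using assms(2) by (simp add: algebra_simps)
  from plane_basis_zeroD[OF assms(1) this] show "s = s'" "t = t'" by auto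
qed

lemma plane_basis_commute: "plane_basis u v \<Longrightarrow> plane_basis v u"
  unfolding plane_basis_def by (metis add.commute)

lemma plane_basis_nonzero:
  assumes "plane_basis u v"
  shows "u \<noteq> 0" "v \<noteq> 0"
  using plane_basis_zeroD[OF assms, of 1 0] plane_basis_zeroD[OF assms, of 0 1] by auto

text \<open>Cramer's rule gives the coordinates in the new pair; the same eliminations, applied to
  the homogeneous equations, give independence.\<close>

lemma plane_basis_of_det:
  assumes B: "plane_basis u v" and det: "a * d - b * c \<noteq> 0"
  shows "plane_basis (a *\<^sub>R u + b *\<^sub>R v) (c *\<^sub>R u + d *\<^sub>R v)"
proof -
  let ?D = "a * d - b * c"
  have span: "\<exists>s t. z = s *\<^sub>R (a *\<^sub>R u + b *\<^sub>R v) + t *\<^sub>R (c *\<^sub>R u + d *\<^sub>R v)" for z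
  proof -
    obtain x y where z: "z = x *\<^sub>R u + y *\<^sub>R v" using plane_basis_ex[OF B] .
    let ?s = "(d * x - c * y) / ?D" and ?t = "(a * y - b * x) / ?D"
    have "?s * a + ?t * c = x" "?s * b + ?t * d = y"
      using det by (simp_all add: divide_simps) (simp_all add: algebra_simps)
    then have "z = (?s * a + ?t * c) *\<^sub>R u + (?s * b + ?t * d) *\<^sub>R v" using z by simp
    also have "\<dots> = ?s *\<^sub>R (a *\<^sub>R u + b *\<^sub>R v) + ?t *\<^sub>R (c *\<^sub>R u + d *\<^sub>R v)"
      by (simp only: scaleR_add_left scaleR_add_right scaleR_scaleR) (simp add: add_ac)
    finally show ?thesis by blast
  qed
  have indep: "s = 0 \<and> t = 0"
    if "s *\<^sub>R (a *\<^sub>R u + b *\<^sub>R v) + t *\<^sub>R (c *\<^sub>R u + d *\<^sub>R v) = 0" for s t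
  proof -
    have "(s * a + t * c) *\<^sub>R u + (s * b + t * d) *\<^sub>R v = 0"
      using that by (simp add: algebra_simps)
    then have e: "s * a + t * c = 0" "s * b + t * d = 0" using plane_basis_zeroD[OF B] by blast+
    have "s * ?D = d * (s * a + t * c) - c * (s * b + t * d)"
      "t * ?D = a * (s * b + t * d) - b * (s * a + t * c)"
      by (simp_all add: algebra_simps)
    then show ?thesis using det by (simp only: e) simp
  qed
  show ?thesis unfolding plane_basis_def using span indep by blast
qed

lemma plane_basis_extend:
  fixes u v x :: "'a::real_vector"
  assumes B: "plane_basis u v" and "x \<noteq> 0"
  obtains y where "plane_basis x y"
proof -
  obtain a b where x: "x = a *\<^sub>R u + b *\<^sub>R v" using plane_basis_ex[OF B] .
  show ?thesis
  proof (cases "a = 0")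
    case True
    then have "b \<noteq> 0" using x \<open>x \<noteq> 0\<close> by auto
    then have "plane_basis x (1 *\<^sub>R u + 0 *\<^sub>R v)"
      unfolding x by (intro plane_basis_of_det[OF B]) simp
    then show ?thesis by (rule that)
  next
    case False
    then have "plane_basis x (0 *\<^sub>R u + 1 *\<^sub>R v)"
      unfolding x by (intro plane_basis_of_det[OF B]) simp
    then show ?thesis by (rule that)
  qed
qed

lemma plane_basis_imp_span:
  assumes "plane_basis u v"
  shows "span {u, v} = UNIV"
proof -
  have "z \<in> span {u, v}" for z
    by (rule plane_basis_ex[OF assms, of z])
      (simp add: span_add span_base span_scale)
  then show ?thesis by blast
qed

lemma plane_basis_of_dim:
  assumes "dim (UNIV :: ('a::real_vector) set) = 2"
  obtains u v :: "'a::real_vector" where "plane_basis u v"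
proof -
  obtain B :: "'a set" where B: "independent B" "UNIV \<subseteq> span B" "card B = 2"
    using basis_exists[of "UNIV :: 'a set"] assms by metis
  obtain u v where uv: "B = {u, v}" "u \<noteq> v" using B(3) by (auto simp: card_2_iff)
  have "\<exists>s t. z = s *\<^sub>R u + t *\<^sub>R v" for z
  proof -
    have "z \<in> span {u, v}" using B(2) uv by blast
    then obtain s t where "z - s *\<^sub>R u = t *\<^sub>R v"
      by (auto simp: span_insert span_singleton)
    then show ?thesis by (metis add.commute diff_add_cancel)
  qed
  moreover have "s = 0 \<and> t = 0" if "s *\<^sub>R u + t *\<^sub>R v = 0" for s t
  proof -
    have "(\<Sum>x\<in>{u, v}. (if x = u then s else t) *\<^sub>R x) = 0" using that uv by simp
    then show ?thesis
      using independentD[OF B(1), of "{u, v}" "\<lambda>x. if x = u then s else t" u]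
        independentD[OF B(1), of "{u, v}" "\<lambda>x. if x = u then s else t" v] uv by auto
  qed
  ultimately have "plane_basis u v" unfolding plane_basis_def by blast
  then show ?thesis by (rule that)
qed

section \<open>Segments on spheres and their directions\<close>

text \<open>For \<open>x \<noteq> 0\<close> this says that \<open>d\<close> is an interior point of
  a segment parallel to \<open>x\<close> on the sphere through \<open>d\<close>.\<close>

definition flat_along :: "'a::real_normed_vector \<Rightarrow> 'a \<Rightarrow> bool" where
  "flat_along x d \<longleftrightarrow> (\<exists>e>0. \<forall>t. \<bar>t\<bar> < e \<longrightarrow> norm (d + t *\<^sub>R x) = norm d)"

text \<open>Dividing by \<open>s\<close> moves the point back onto the segment. Hence on the cone
  over the segment the norm is linear in \<open>s\<close> and does not depend on
  \<open>t\<close>.\<close>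

lemma flat_along_cone:
  assumes flat: "\<And>t. \<bar>t\<bar> < e \<Longrightarrow> norm (d + t *\<^sub>R x) = norm d"
    and "s > 0" "\<bar>t\<bar> < s * e"
  shows "norm (s *\<^sub>R d + t *\<^sub>R x) = s * norm d"
proof -
  have "s *\<^sub>R d + t *\<^sub>R x = s *\<^sub>R (d + (t / s) *\<^sub>R x)" using assms by (simp add: scaleR_add_right)
  moreover have "\<bar>t / s\<bar> < e" using assms by (simp add: abs_divide divide_simps mult.commute)
  ultimately show ?thesis using flat assms(2) by simp
qed

text \<open>Near \<open>d\<close> the norm agrees with a linear functional that vanishes on
  \<open>x\<close>. Along the second direction it therefore changes at rate
  \<open>a * norm d\<close>, and flatness makes this rate 0.\<close>

lemma flat_along_unique:
  assumes B: "plane_basis d x" and "flat_along x d" "flat_along (a *\<^sub>R d + b *\<^sub>R x) d"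
  shows "a = 0"
proof -
  obtain e where e: "e > 0" "\<And>t. \<bar>t\<bar> < e \<Longrightarrow> norm (d + t *\<^sub>R x) = norm d"
    using assms(2) unfolding flat_along_def by blast
  obtain e' where e': "e' > 0"
    "\<And>t. \<bar>t\<bar> < e' \<Longrightarrow> norm (d + t *\<^sub>R (a *\<^sub>R d + b *\<^sub>R x)) = norm d"
    using assms(3) unfolding flat_along_def by blast
  have "((\<lambda>t::real. 1 + t * a) \<longlongrightarrow> 1 + 0 * a) (at_right 0)"
    by (intro tendsto_intros)
  then have ev1: "\<forall>\<^sub>F t in at_right 0. 1 + t * a > 0"
    by (rule order_tendstoD) simp
  have "((\<lambda>t::real. (1 + t * a) * e - \<bar>t * b\<bar>) \<longlongrightarrow> (1 + 0 * a) * e - \<bar>0 * b\<bar>) (at_right 0)"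
    by (intro tendsto_intros)
  then have ev2: "\<forall>\<^sub>F t in at_right 0. (1 + t * a) * e - \<bar>t * b\<bar> > 0"
    by (rule order_tendstoD) (use e in simp)
  have ev3: "\<forall>\<^sub>F t in at_right 0. t < e'" and ev4: "\<forall>\<^sub>F t::real in at_right 0. t > 0"
    using e'(1) by (auto simp: eventually_at_right_less eventually_at_right_field)
  \<comment> \<open>A small positive \<open>t\<close> keeps the displaced point inside the cone over
    the first segment and within the range \<open>e'\<close> of the second.\<close>
  have "\<forall>\<^sub>F t in at_right 0. 1 + t * a > 0 \<and> (1 + t * a) * e - \<bar>t * b\<bar> > 0 \<and> t < e' \<and> t > 0"
    using ev1 ev2 ev3 ev4 by eventually_elim auto
  then obtain t where t: "1 + t * a > 0" "(1 + t * a) * e - \<bar>t * b\<bar> > 0" "t < e'" "t > 0"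
    using eventually_happens[of _ "at_right (0::real)"] by auto
  have "norm ((1 + t * a) *\<^sub>R d + (t * b) *\<^sub>R x) = (1 + t * a) * norm d"
    by (rule flat_along_cone[OF e(2)]) (use t in auto)
  moreover have "(1 + t * a) *\<^sub>R d + (t * b) *\<^sub>R x = d + t *\<^sub>R (a *\<^sub>R d + b *\<^sub>R x)"
    by (simp add: algebra_simps)
  ultimately have "(1 + t * a) * norm d = norm d" using e'(2)[of t] t by simp
  then show ?thesis using plane_basis_nonzero[OF B] t by simp
qed

lemma flat_along_not_parallel:
  assumes "flat_along x (a *\<^sub>R x)" "x \<noteq> 0"
  shows False
proof -
  obtain e where e: "e > 0" "\<And>t. \<bar>t\<bar> < e \<Longrightarrow> norm (a *\<^sub>R x + t *\<^sub>R x) = norm (a *\<^sub>R x)"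
    using assms(1) unfolding flat_along_def by blast
  have "norm (a *\<^sub>R x + t *\<^sub>R x) = \<bar>a + t\<bar> * norm x" for t
    by (metis norm_scaleR scaleR_add_left)
  then have "\<bar>a + t\<bar> = \<bar>a\<bar>" if "\<bar>t\<bar> < e" for t using e(2)[OF that] assms(2) by simp
  \<comment> \<open>For \<open>t \<noteq> 0\<close> the equation forces \<open>t = - 2 * a\<close>,
    which different values of \<open>t\<close> cannot share.\<close>
  from this[of "e / 2"] this[of "e / 3"] this[of "- e / 2"] this[of "- e / 3"]
  show False using e(1) by (simp add: abs_if split: if_splits)
qed

text \<open>The cone over a segment has nonempty interior, so it contains a point of a countable
  dense set, and the norm is flat there in the direction of the segment. By
  \<open>flat_along_unique\<close> a point determines its flat slope, so choosing such a point for
  each slope is injective.\<close>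

lemma countable_flat_slopes:
  assumes B: "plane_basis p q"
  shows "countable {m. \<exists>d. flat_along (p + m *\<^sub>R q) d}"
proof -
  obtain D :: "(real \<times> real) set" where D: "countable D" "\<And>X. open X \<Longrightarrow> X \<noteq> {} \<Longrightarrow> \<exists>d\<in>D. d \<in> X"
    using countable_dense_setE by metis
  let ?c = "\<lambda>z. fst z *\<^sub>R p + snd z *\<^sub>R q"
  let ?S = "{m. \<exists>d. flat_along (p + m *\<^sub>R q) d}"
  have Bm: "plane_basis (fst z *\<^sub>R p + snd z *\<^sub>R q) (p + m *\<^sub>R q)"
    if fl: "flat_along (p + m *\<^sub>R q) (?c z)" for z m
  proof -
    have "fst z * m - snd z * 1 \<noteq> 0"
    proof
      assume "fst z * m - snd z * 1 = 0"
      then have "?c z = fst z *\<^sub>R (p + m *\<^sub>R q)" by (simp add: algebra_simps)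
      moreover have "p + m *\<^sub>R q \<noteq> 0" using plane_basis_zeroD[OF B, of 1 m] by auto
      ultimately show False using fl flat_along_not_parallel by metis
    qed
    then have "plane_basis (fst z *\<^sub>R p + snd z *\<^sub>R q) (1 *\<^sub>R p + m *\<^sub>R q)"
      by (rule plane_basis_of_det[OF B])
    then show ?thesis by simp
  qed
  have "\<exists>z\<in>D. flat_along (p + m *\<^sub>R q) (?c z)" if "m \<in> ?S" for m
  proof -
    obtain w where w: "flat_along (p + m *\<^sub>R q) w" using \<open>m \<in> ?S\<close> by blast
    obtain w1 w2 where w12: "w = w1 *\<^sub>R p + w2 *\<^sub>R q" using plane_basis_ex[OF B] .
    obtain e where e: "e > 0" "\<And>t. \<bar>t\<bar> < e \<Longrightarrow> norm (w + t *\<^sub>R (p + m *\<^sub>R q)) = norm w"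
      using w unfolding flat_along_def by blast
    let ?\<Delta> = "w1 * m - w2"
    have \<Delta>: "?\<Delta> \<noteq> 0"
    proof
      assume "?\<Delta> = 0"
      then have "w = w1 *\<^sub>R (p + m *\<^sub>R q)" by (simp add: w12 algebra_simps)
      moreover have "p + m *\<^sub>R q \<noteq> 0" using plane_basis_zeroD[OF B, of 1 m] by auto
      ultimately show False using w flat_along_not_parallel by metis
    qed
    \<comment> \<open>By Cramer's rule these are the coordinates of \<open>?c z\<close> with respect
      to \<open>w\<close> and \<open>p + m *\<^sub>R q\<close>. The set \<open>?U\<close> is the
      open cone over the segment; at \<open>(w1, w2)\<close> the coordinates are 1 and 0.\<close>
    let ?s = "\<lambda>z. (m * fst z - snd z) / ?\<Delta>" and ?u = "\<lambda>z. (w1 * snd z - w2 * fst z) / ?\<Delta>"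
    let ?U = "{z. 0 < ?s z} \<inter> {z. \<bar>?u z\<bar> < ?s z * e}"
    have "open ?U"
      by (intro open_Int open_Collect_less continuous_intros) (use \<Delta> in auto)
    moreover have "(w1, w2) \<in> ?U"
      using \<Delta> e(1) by (simp add: mult.commute)
    ultimately obtain z where z: "z \<in> D" "z \<in> ?U" using D(2) by blast
    have c: "?s z * w1 + ?u z = fst z" "?s z * w2 + ?u z * m = snd z"
      using \<Delta> by (simp_all add: divide_simps) (simp_all add: algebra_simps)
    have cz: "?c z = ?s z *\<^sub>R w + ?u z *\<^sub>R (p + m *\<^sub>R q)"
    proof -
      have "?c z = (?s z * w1 + ?u z) *\<^sub>R p + (?s z * w2 + ?u z * m) *\<^sub>R q"
        unfolding c ..
      also have "\<dots> = ?s z *\<^sub>R w + ?u z *\<^sub>R (p + m *\<^sub>R q)"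
        unfolding w12
        by (simp only: scaleR_add_left scaleR_add_right scaleR_scaleR) (simp add: add_ac)
      finally show ?thesis .
    qed
    \<comment> \<open>The bound on \<open>t\<close> is the room left before the displaced point
      leaves the cone.\<close>
    have "norm (?c z + t *\<^sub>R (p + m *\<^sub>R q)) = norm (?c z)" if "\<bar>t\<bar> < ?s z * e - \<bar>?u z\<bar>" for t
    proof -
      have "\<bar>?u z + t\<bar> < ?s z * e" 
        by (rule order_le_less_trans[OF abs_triangle_ineq]) (use that in \<open>simp only: less_diff_eq add.commute\<close>)
      then have "norm (?s z *\<^sub>R w + (?u z + t) *\<^sub>R (p + m *\<^sub>R q)) = ?s z * norm w"
        by (intro flat_along_cone[OF e(2)]) (use z in auto)
      moreover have "norm (?s z *\<^sub>R w + ?u z *\<^sub>R (p + m *\<^sub>R q)) = ?s z * norm w"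
        by (rule flat_along_cone[OF e(2)]) (use z in auto)
      ultimately show ?thesis unfolding cz by (simp only: scaleR_add_left add.assoc)
    qed
    moreover have "?s z * e - \<bar>?u z\<bar> > 0" using z by auto
    ultimately show ?thesis using z(1) unfolding flat_along_def by blast
  qed
  then obtain g where g: "\<And>m. m \<in> ?S \<Longrightarrow> g m \<in> D \<and> flat_along (p + m *\<^sub>R q) (?c (g m))"
    by metis
  have "inj_on g ?S"
  proof (rule inj_onI)
    fix m m' assume m: "m \<in> ?S" "m' \<in> ?S" "g m = g m'"
    have f: "flat_along (p + m *\<^sub>R q) (?c (g m))" "flat_along (p + m' *\<^sub>R q) (?c (g m))"
      using g m by metis+
    obtain a b where ab: "p + m' *\<^sub>R q = a *\<^sub>R (?c (g m)) + b *\<^sub>R (p + m *\<^sub>R q)"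
      using plane_basis_ex[OF Bm[OF f(1)]] .
    have "a = 0" using flat_along_unique[OF Bm[OF f(1)] f(1)] f(2) ab by metis
    then have "1 *\<^sub>R p + m' *\<^sub>R q = b *\<^sub>R p + (b * m) *\<^sub>R q" using ab by (simp add: scaleR_add_right)
    from plane_basis_eqD[OF B this] show "m = m'" by simp
  qed
  moreover have "g ` ?S \<subseteq> D" using g by blast
  ultimately show ?thesis using D(1) countable_image_inj_on countable_subset by metis
qed

section \<open>Bisectors and isosceles orthogonality\<close>

lemma mem_bisector_minus_iff:
  "z \<in> bisector (- x) x \<longleftrightarrow> norm (z + x) = norm (z - x)"
proof -
  have "norm (- x - z) = norm (z + x)"
    by (metis minus_add_distrib norm_minus_cancel uminus_add_conv_diff add.commute)
  then show ?thesis by (simp add: bisector_def norm_minus_commute)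
qed

text \<open>As \<open>y\<close> runs along half of the sphere from \<open>l *\<^sub>R x\<close> to
  its antipode, \<open>norm (z + y) - norm (z - y)\<close> changes sign, so the intermediate value
  theorem gives a zero.\<close>

lemma isosceles_orthogonal_on_sphere:
  fixes x v z :: "'a::real_normed_vector"
  assumes B: "plane_basis x v" and "l > 0"
  obtains y where "norm y = l * norm x" "norm (z + y) = norm (z - y)"
proof -
  define g where "g t = cos t *\<^sub>R x + sin t *\<^sub>R v" for t
  have g0: "g t \<noteq> 0" for t
    using plane_basis_zeroD[OF B, of "cos t" "sin t"] sin_cos_squared_add[of t]
    unfolding g_def by force
  have x0: "x \<noteq> 0" using plane_basis_nonzero[OF B] by simp
  define y where "y t = (l * norm x / norm (g t)) *\<^sub>R g t" for t
  have ny: "norm (y t) = l * norm x" for t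
    using g0[of t] x0 \<open>l > 0\<close> by (simp add: y_def)
  define h where "h t = norm (z + y t) - norm (z - y t)" for t
  have "norm (cos t *\<^sub>R x + sin t *\<^sub>R v) \<noteq> 0" for t using g0[of t] by (simp add: g_def)
  then have cont: "continuous_on {0..pi} h"
    unfolding h_def y_def g_def by (intro continuous_intros ballI)
  have "g pi = - g 0" by (simp add: g_def)
  then have "y pi = - y 0" by (simp add: y_def)
  then have hpi: "h pi = - h 0" by (simp add: h_def)
  obtain t where "h t = 0"
  proof (cases "h 0 \<le> 0")
    case True
    then show ?thesis using IVT'[of h 0 0 pi] cont hpi that by auto
  next
    case False
    then show ?thesis using IVT2'[of h pi 0 0] cont hpi that by auto
  qed
  then show ?thesis using that[of "y t"] ny by (simp add: h_def)
qed

text \<open>For \<open>z \<noteq> 0\<close>, some \<open>y\<close> of norm \<open>l * norm x\<close>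
  has \<open>z\<close> in its bisector. By \<open>triv\<close> it cannot be independent of
  \<open>x\<close>, so it is \<open>l *\<^sub>R x\<close> or its negative.\<close>

lemma isosceles_orthogonal_scale:
  assumes B: "plane_basis x v" and "l > 0"
    and triv: "\<And>y. norm y = l * norm x \<Longrightarrow> span {x, y} = UNIV \<Longrightarrow>
      bisector (- x) x \<inter> bisector (- y) y = {0}"
    and z: "norm (z + x) = norm (z - x)"
  shows "norm (z + l *\<^sub>R x) = norm (z - l *\<^sub>R x)"
proof (cases "z = 0")
  case False
  obtain y where y: "norm y = l * norm x" "norm (z + y) = norm (z - y)"
    using isosceles_orthogonal_on_sphere[OF B \<open>l > 0\<close>] .
  obtain s t where st: "y = s *\<^sub>R x + t *\<^sub>R v" using plane_basis_ex[OF B] .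
  have "t = 0"
  proof (rule ccontr)
    assume "t \<noteq> 0"
    then have "plane_basis (1 *\<^sub>R x + 0 *\<^sub>R v) (s *\<^sub>R x + t *\<^sub>R v)"
      by (intro plane_basis_of_det[OF B]) simp
    then have "span {x, y} = UNIV" using plane_basis_imp_span st by force
    then have "z \<in> {0}" using triv[OF y(1)] y(2) z mem_bisector_minus_iff by blast
    then show False using False by simp
  qed
  then have "\<bar>s\<bar> = l" using y(1) st plane_basis_nonzero[OF B] by simp
  then have "s = l \<or> s = - l" by linarith
  then show ?thesis using y(2) st \<open>t = 0\<close> by auto
qed simp

section \<open>Norms along a line and the construction of reflections\<close>

text \<open>The norm is convex along the line, so beyond its minimum it can fail to increase
  strictly only by staying at the minimum on an interval, and that is a segment parallel to
  \<open>x\<close>.\<close>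

lemma norm_line_strict_mono:
  assumes min: "\<And>t. norm w \<le> norm (w + t *\<^sub>R x)" and nf: "\<And>d. \<not> flat_along x d"
    and "0 \<le> s" "s < t"
  shows "norm (w + s *\<^sub>R x) < norm (w + t *\<^sub>R x)"
proof -
  have conv: "norm (w + (a * t) *\<^sub>R x) \<le> (1 - a) * norm w + a * norm (w + t *\<^sub>R x)"
    if "0 \<le> a" "a \<le> 1" for a t
  proof -
    have "w + (a * t) *\<^sub>R x = (1 - a) *\<^sub>R w + a *\<^sub>R (w + t *\<^sub>R x)"
      by (simp add: algebra_simps)
    then show ?thesis
      using norm_triangle_ineq[of "(1 - a) *\<^sub>R w" "a *\<^sub>R (w + t *\<^sub>R x)"] that by simp
  qed
  have t: "t > 0" using assms by simp
  have strict: "norm w < norm (w + t *\<^sub>R x)"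
  proof (rule ccontr)
    assume "\<not> norm w < norm (w + t *\<^sub>R x)"
    then have eq: "norm (w + t *\<^sub>R x) = norm w" using min[of t] by simp
    have const: "norm (w + u *\<^sub>R x) = norm w" if "0 \<le> u" "u \<le> t" for u
      using conv[of "u / t" t] min[of u] that t by (simp add: eq field_simps)
    \<comment> \<open>The midpoint of the interval of constancy is used because flatness is
      two-sided.\<close>
    have "norm ((w + (t / 2) *\<^sub>R x) + u *\<^sub>R x) = norm (w + (t / 2) *\<^sub>R x)" if "\<bar>u\<bar> < t / 2" for u
    proof -
      have e: "(w + (t / 2) *\<^sub>R x) + u *\<^sub>R x = w + (t / 2 + u) *\<^sub>R x" by (simp add: scaleR_add_left)
      have "0 \<le> t / 2 + u" "t / 2 + u \<le> t" using that by linarith+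
      then show ?thesis unfolding e using const[of "t / 2 + u"] const[of "t / 2"] t by simp
    qed
    then have "flat_along x (w + (t / 2) *\<^sub>R x)" unfolding flat_along_def using t
      by (intro exI[of _ "t / 2"]) simp
    then show False using nf by blast
  qed
  have "norm (w + s *\<^sub>R x) \<le> (1 - s / t) * norm w + s / t * norm (w + t *\<^sub>R x)"
    using conv[of "s / t" t] assms t by simp
  also have "\<dots> < (1 - s / t) * norm (w + t *\<^sub>R x) + s / t * norm (w + t *\<^sub>R x)"
    using strict assms t by (intro add_strict_right_mono mult_strict_left_mono) auto
  also have "\<dots> = norm (w + t *\<^sub>R x)" by (simp add: algebra_simps)
  finally show ?thesis .
qed

lemma norm_line_attains_min:
  fixes v x :: "'a::real_normed_vector"
  assumes "x \<noteq> 0"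
  obtains r where "\<And>t. norm (v + r *\<^sub>R x) \<le> norm (v + t *\<^sub>R x)"
proof -
  \<comment> \<open>For \<open>\<bar>t\<bar> > M\<close> the triangle inequality bounds the norm
    below by \<open>M * norm x - norm v = norm v\<close>, the value at \<open>t = 0\<close>. The
    minimum over the compact interval is therefore global.\<close>
  define M where "M = 2 * norm v / norm x"
  have "M \<ge> 0" unfolding M_def by simp
  have "continuous_on {- M..M} (\<lambda>t. norm (v + t *\<^sub>R x))"
    by (intro continuous_intros)
  then have "\<exists>r\<in>{- M..M}. \<forall>t\<in>{- M..M}. norm (v + r *\<^sub>R x) \<le> norm (v + t *\<^sub>R x)"
    using \<open>M \<ge> 0\<close> by (intro continuous_attains_inf) auto
  then obtain r where r: "\<And>t. t \<in> {- M..M} \<Longrightarrow> norm (v + r *\<^sub>R x) \<le> norm (v + t *\<^sub>R x)"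
    by blast
  have "norm (v + r *\<^sub>R x) \<le> norm (v + t *\<^sub>R x)" for t
  proof (cases "\<bar>t\<bar> \<le> M")
    case True
    then have "t \<in> {- M..M}" by auto
    then show ?thesis by (rule r)
  next
    case False
    have "norm (v + r *\<^sub>R x) \<le> norm v" using r[of 0] \<open>M \<ge> 0\<close> by simp
    also have "norm v = M * norm x - norm v" using assms by (simp add: M_def)
    also have "\<dots> \<le> \<bar>t\<bar> * norm x - norm v" using False by (simp add: mult_right_mono)
    also have "\<dots> \<le> norm (v + t *\<^sub>R x)"
      using norm_triangle_ineq2[of "t *\<^sub>R x" "- v"] by (simp add: add.commute)
    finally show ?thesis .
  qed
  then show ?thesis by (rule that)
qed

text \<open>On the line \<open>w + t x\<close>, with \<open>w\<close> its point of least norm, let \<open>r(A)\<close> be the midpoint of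
  the chord of half-length \<open>A\<close> whose endpoints have equal norm.  Then \<open>r(l A) = r(A)\<close> and
  \<open>\<bar>r(A)\<bar> < A\<close>, and letting the scale tend to 0 forces \<open>r = 0\<close>.\<close>
lemma reflection_of_scale_invariance:
  assumes B: "plane_basis x v" and nf: "\<And>d. \<not> flat_along x d"
    and l: "l > 0" "l \<noteq> 1"
    and scale: "\<And>z. norm (z + x) = norm (z - x) \<Longrightarrow> norm (z + l *\<^sub>R x) = norm (z - l *\<^sub>R x)"
  obtains w where "plane_basis x w" "\<And>a b. norm (a *\<^sub>R w - b *\<^sub>R x) = norm (a *\<^sub>R w + b *\<^sub>R x)"
proof -
  have x0: "x \<noteq> 0" using plane_basis_nonzero[OF B] by simp
  obtain r0 where r0: "\<And>t. norm (v + r0 *\<^sub>R x) \<le> norm (v + t *\<^sub>R x)"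
    using norm_line_attains_min[OF x0, of v] by blast
  define w where "w = v + r0 *\<^sub>R x"
  have "plane_basis (1 *\<^sub>R x + 0 *\<^sub>R v) (r0 *\<^sub>R x + 1 *\<^sub>R v)"
    by (intro plane_basis_of_det[OF B]) simp
  then have Bw: "plane_basis x w" by (simp add: w_def add.commute)
  define k where "k t = norm (w + t *\<^sub>R x)" for t
  have min: "norm w \<le> norm (w + t *\<^sub>R x)" for t
    using r0[of "r0 + t"] by (simp add: w_def scaleR_add_left add.assoc)
  have incr: "k s < k t" if "0 \<le> s" "s < t" for s t
    unfolding k_def by (rule norm_line_strict_mono[OF min nf that])
  \<comment> \<open>Replacing \<open>x\<close> by \<open>- x\<close> carries the monotonicity over
    to the other half of the line.\<close>
  have nf': "\<not> flat_along (- x) d" for d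
  proof
    assume "flat_along (- x) d"
    then obtain e where e: "e > 0" "\<And>t. \<bar>t\<bar> < e \<Longrightarrow> norm (d + t *\<^sub>R (- x)) = norm d"
      unfolding flat_along_def by blast
    have "norm (d + t *\<^sub>R x) = norm d" if "\<bar>t\<bar> < e" for t using e(2)[of "- t"] that by simp
    then show False using nf[of d] e(1) unfolding flat_along_def by blast
  qed
  have min': "norm w \<le> norm (w + t *\<^sub>R (- x))" for t using min[of "- t"] by simp
  have decr: "k s < k t" if "t < s" "s \<le> 0" for s t
    using norm_line_strict_mono[OF min' nf', of "- s" "- t"] that by (simp add: k_def)
  \<comment> \<open>For \<open>r = - A\<close> and for \<open>r = A\<close> one end of the chord is
    at the minimum, so the difference changes sign in between.\<close>
  have ex: "\<exists>r. k (r + A) = k (r - A)" if A: "A > 0" for A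
  proof -
    let ?h = "\<lambda>r. k (r + A) - k (r - A)"
    have "continuous_on {- A..A} ?h" unfolding k_def by (intro continuous_intros)
    moreover have "?h (- A) \<le> 0" "0 \<le> ?h A"
      using decr[of "- A - A" 0] incr[of 0 "A + A"] that by auto
    ultimately obtain r where "?h r = 0" using IVT'[of ?h "- A" 0 A] A by auto
    then show ?thesis by auto
  qed
  \<comment> \<open>Otherwise the whole chord lies on one side of the minimum, where
    \<open>k\<close> is strictly monotone.\<close>
  have bound: "\<bar>r\<bar> < A" if "A > 0" "k (r + A) = k (r - A)" for r A
  proof (rule ccontr)
    assume "\<not> \<bar>r\<bar> < A"
    then consider "r - A \<ge> 0" | "r + A \<le> 0" by linarith
    then show False
    proof cases
      case 1 then show False using incr[of "r - A" "r + A"] that by simp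
    next
      case 2 then show False using decr[of "r - A" "r + A"] that by simp
    qed
  qed
  \<comment> \<open>Moving the chord to the right raises the norm at its right end and lowers it at
    its left end.\<close>
  have uniq_le: "\<not> r < r'" if "A > 0" "k (r + A) = k (r - A)" "k (r' + A) = k (r' - A)" for r r' A
  proof
    assume "r < r'"
    then have "k (r + A) < k (r' + A)" "k (r' - A) < k (r - A)"
      using bound[OF that(1,2)] bound[OF that(1,3)] incr decr by simp_all
    then show False using that by simp
  qed
  have step: "k (r + l * A) = k (r - l * A)" if "A > 0" "k (r + A) = k (r - A)" for r A
  proof -
    \<comment> \<open>Division by \<open>A\<close> turns the ends of the chord into
      \<open>?z + x\<close> and \<open>?z - x\<close>, to which \<open>scale\<close>
      applies.\<close>
    let ?z = "(1 / A) *\<^sub>R (w + r *\<^sub>R x)"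
    have n: "norm (?z + c *\<^sub>R x) = k (r + c * A) / A" "norm (?z - c *\<^sub>R x) = k (r - c * A) / A" for c
    proof -
      have "?z + c *\<^sub>R x = (1 / A) *\<^sub>R (w + (r + c * A) *\<^sub>R x)"
        "?z - c *\<^sub>R x = (1 / A) *\<^sub>R (w + (r - c * A) *\<^sub>R x)"
        using that(1) by (simp_all add: scaleR_add_left scaleR_add_right scaleR_diff_left scaleR_diff_right)
      then show "norm (?z + c *\<^sub>R x) = k (r + c * A) / A" "norm (?z - c *\<^sub>R x) = k (r - c * A) / A"
        using that(1) by (simp_all add: k_def)
    qed
    have "norm (?z + x) = norm (?z - x)" using n[of 1] that by simp
    from scale[OF this] show ?thesis using n[of l] that(1) by simp
  qed
  have steps: "k (r + l ^ n * A) = k (r - l ^ n * A)" if "A > 0" "k (r + A) = k (r - A)" for r A n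
  proof (induction n)
    case (Suc n)
    then show ?case using step[of "l ^ n * A" r] that l by (simp add: mult.assoc)
  qed (use that in simp)
  have sym: "k A = k (- A)" if "A > 0" for A
  proof -
    obtain r where r: "k (r + A) = k (r - A)" using ex[OF \<open>A > 0\<close>] by blast
    \<comment> \<open>All chords of half-length \<open>l ^ n * A\<close> have the same midpoint. For
      \<open>l < 1\<close> they shrink, and \<open>bound\<close> applies directly.\<close>
    have small: "\<bar>r\<bar> < min l (1 / l) ^ n * A" for n
    proof (cases "l < 1")
      case True
      then have "min l (1 / l) = l" using l by (simp add: min_def field_simps) (smt (verit) mult_le_one)
      then show ?thesis using bound[OF _ steps[OF \<open>A > 0\<close> r, of n]] l \<open>A > 0\<close> by simp
    next
      case False
      then have "1 / l < l" using l by (simp add: field_simps) (smt (verit) mult_less_cancel_left2)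
      then have ml: "min l (1 / l) = 1 / l" by simp
      \<comment> \<open>For \<open>l > 1\<close> the argument starts from a short chord and enlarges
        it to half-length \<open>A\<close>; uniqueness identifies its midpoint with
        \<open>r\<close>.\<close>
      let ?A = "A / l ^ n"
      have A: "?A > 0" "l ^ n * ?A = A" using l \<open>A > 0\<close> by simp_all
      obtain r' where r': "k (r' + ?A) = k (r' - ?A)" using ex[OF A(1)] by blast
      have "k (r' + A) = k (r' - A)" using steps[OF A(1) r', of n] A(2) by simp
      then have "r' = r" using uniq_le[OF \<open>A > 0\<close> r] uniq_le[OF \<open>A > 0\<close> _ r] by force
      then have "\<bar>r\<bar> < ?A" using bound[OF A(1) r'] by simp
      then show ?thesis by (simp add: ml power_one_over)
    qed
    have "0 \<le> min l (1 / l)" "min l (1 / l) < 1"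
      using l by (cases "l < 1"; simp add: min_less_iff_disj)+
    then have "(\<lambda>n. min l (1 / l) ^ n * A) \<longlonglongrightarrow> 0 * A"
      by (intro tendsto_intros LIMSEQ_realpow_zero)
    then have "\<bar>r\<bar> \<le> 0 * A" by (rule LIMSEQ_le_const) (use small less_imp_le in blast)
    then show ?thesis using r by simp
  qed
  have symm: "k A = k (- A)" for A
    using sym[of A] sym[of "- A"] by (cases A "0::real" rule: linorder_cases) auto
  have "norm (a *\<^sub>R w - b *\<^sub>R x) = norm (a *\<^sub>R w + b *\<^sub>R x)" for a b
  proof (cases "a = 0")
    case False
    have "a *\<^sub>R w - b *\<^sub>R x = a *\<^sub>R (w + (- (b / a)) *\<^sub>R x)" "a *\<^sub>R w + b *\<^sub>R x = a *\<^sub>R (w + (b / a) *\<^sub>R x)"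
      using False by (simp_all add: scaleR_add_right scaleR_diff_right)
    then show ?thesis using symm[of "b / a"] unfolding k_def by simp
  qed simp
  then show ?thesis using that Bw by blast
qed

section \<open>Linear isometries as matrices\<close>

text \<open>The matrix has rows \<open>a b\<close> and \<open>c d\<close> and acts on the
  coordinates \<open>s\<close>, \<open>t\<close>; it sends \<open>p\<close> to
  \<open>a *\<^sub>R p + c *\<^sub>R q\<close>. Explicit entries make traces and determinants
  available as polynomials.\<close>

definition coord_isometry ::
    "'a::real_normed_vector \<Rightarrow> 'a \<Rightarrow> real \<Rightarrow> real \<Rightarrow> real \<Rightarrow> real \<Rightarrow> bool" where
  "coord_isometry p q a b c d \<longleftrightarrow>
     (\<forall>s t. norm ((a * s + b * t) *\<^sub>R p + (c * s + d * t) *\<^sub>R q) = norm (s *\<^sub>R p + t *\<^sub>R q))"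

lemma coord_isometryD:
  "coord_isometry p q a b c d \<Longrightarrow>
     norm ((a * s + b * t) *\<^sub>R p + (c * s + d * t) *\<^sub>R q) = norm (s *\<^sub>R p + t *\<^sub>R q)"
  unfolding coord_isometry_def by blast

lemma coord_isometry_comp:
  assumes A: "coord_isometry p q a b c d" and A': "coord_isometry p q a' b' c' d'"
  shows "coord_isometry p q (a * a' + b * c') (a * b' + b * d') (c * a' + d * c') (c * b' + d * d')"
  unfolding coord_isometry_def
proof (intro allI)
  fix s t
  have e: "(a * a' + b * c') * s + (a * b' + b * d') * t = a * (a' * s + b' * t) + b * (c' * s + d' * t)"
    "(c * a' + d * c') * s + (c * b' + d * d') * t = c * (a' * s + b' * t) + d * (c' * s + d' * t)"
    by (simp_all add: algebra_simps)
  show "norm (((a * a' + b * c') * s + (a * b' + b * d') * t) *\<^sub>R p +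
      ((c * a' + d * c') * s + (c * b' + d * d') * t) *\<^sub>R q) = norm (s *\<^sub>R p + t *\<^sub>R q)"
    unfolding e coord_isometryD[OF A] coord_isometryD[OF A'] ..
qed

text \<open>By Cayley--Hamilton \<open>A\<^sup>2 p + p = tr(A) A p\<close>, and \<open>p\<close>, \<open>A p\<close>, \<open>A\<^sup>2 p\<close> have equal norm.\<close>
lemma coord_isometry_trace_le:
  assumes A: "coord_isometry p q a b c d" and det: "a * d - b * c = 1" and p: "p \<noteq> 0"
  shows "\<bar>a + d\<bar> \<le> 2"
proof -
  have n1: "norm (a *\<^sub>R p + c *\<^sub>R q) = norm p" using coord_isometryD[OF A, of 1 0] by simp
  have n2: "norm ((a * a + b * c) *\<^sub>R p + (c * a + d * c) *\<^sub>R q) = norm p"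
    using coord_isometryD[OF A, of a c] n1 by simp
  have "a * a + b * c + 1 = (a + d) * a" "c * a + d * c = (a + d) * c"
    using det by (simp_all add: algebra_simps)
  then have "(a + d) *\<^sub>R (a *\<^sub>R p + c *\<^sub>R q) = (a * a + b * c + 1) *\<^sub>R p + (c * a + d * c) *\<^sub>R q"
    by (simp only: scaleR_add_right scaleR_scaleR)
  also have "\<dots> = ((a * a + b * c) *\<^sub>R p + (c * a + d * c) *\<^sub>R q) + p"
    by (simp add: scaleR_add_left)
  finally have "(a + d) *\<^sub>R (a *\<^sub>R p + c *\<^sub>R q) = \<dots>" .
  then have "norm ((a + d) *\<^sub>R (a *\<^sub>R p + c *\<^sub>R q)) \<le> norm p + norm p"
    using norm_triangle_ineq[of "(a * a + b * c) *\<^sub>R p + (c * a + d * c) *\<^sub>R q" p] n2 by simp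
  then have "\<bar>a + d\<bar> * norm p \<le> 2 * norm p" using n1 by simp
  then show ?thesis using p by simp
qed

text \<open>The square has determinant 1 and trace \<open>(a + d)^2 + 2\<close>; since this trace is
  at most 2, \<open>a + d\<close> vanishes.\<close>

lemma coord_isometry_trace_zero:
  assumes A: "coord_isometry p q a b c d" and det: "a * d - b * c = -1" and p: "p \<noteq> 0"
  shows "a + d = 0"
proof -
  have "(a * a + b * c) * (c * b + d * d) - (a * b + b * d) * (c * a + d * c) = (a * d - b * c)\<^sup>2"
    by (simp add: algebra_simps power2_eq_square)
  then have "\<bar>(a * a + b * c) + (c * b + d * d)\<bar> \<le> 2"
    by (intro coord_isometry_trace_le[OF coord_isometry_comp[OF A A] _ p]) (simp add: det)
  moreover have "(a * a + b * c) + (c * b + d * d) = (a + d)\<^sup>2 - 2 * (a * d - b * c)"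
    by (simp add: algebra_simps power2_eq_square)
  ultimately have "(a + d)\<^sup>2 \<le> 0" using det by simp
  then show ?thesis by simp
qed

text \<open>This is the matrix of the reflection that fixes \<open>w\<close> and negates
  \<open>p + m *\<^sub>R q\<close>. Trace 0 is built into the entry \<open>- a\<close>, the first
  equation is determinant -1, and the last two express the negation.\<close>

lemma reflection_matrix:
  assumes B: "plane_basis p q" and Bw: "plane_basis (p + m *\<^sub>R q) w"
    and refl: "\<And>\<alpha> \<beta>. norm (\<alpha> *\<^sub>R w - \<beta> *\<^sub>R (p + m *\<^sub>R q)) = norm (\<alpha> *\<^sub>R w + \<beta> *\<^sub>R (p + m *\<^sub>R q))"
  obtains a b c where "coord_isometry p q a b c (- a)" "a * a + b * c = 1"
    "a + b * m = -1" "c - a * m = - m"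
proof -
  obtain w1 w2 where w: "w = w1 *\<^sub>R p + w2 *\<^sub>R q" using plane_basis_ex[OF B] .
  define \<Delta> where "\<Delta> = w2 - m * w1"
  have \<Delta>: "\<Delta> \<noteq> 0"
  proof
    assume "\<Delta> = 0"
    then have "w1 *\<^sub>R (p + m *\<^sub>R q) + (-1) *\<^sub>R w = 0" by (simp add: \<Delta>_def w algebra_simps)
    then show False using plane_basis_zeroD(2)[OF Bw] by fastforce
  qed
  \<comment> \<open>The entries are read off from \<open>z - 2 * \<beta> * (p + m q)\<close>, where
    \<open>\<beta>\<close> is the coordinate of \<open>z\<close> along \<open>p + m q\<close> in the
    basis with \<open>w\<close>.\<close>
  define a b c where "a = 1 - 2 * w2 / \<Delta>" and "b = 2 * w1 / \<Delta>" and "c = - 2 * m * w2 / \<Delta>"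
  have d: "1 + 2 * m * w1 / \<Delta> = - a" 
    unfolding a_def using \<Delta> by (simp add: divide_simps) (simp add: \<Delta>_def algebra_simps)
  have "coord_isometry p q a b c (- a)"
    unfolding coord_isometry_def
  proof (intro allI)
    fix s t
    let ?\<alpha> = "(t - m * s) / \<Delta>" and ?\<beta> = "(s * w2 - t * w1) / \<Delta>"
    have e: "?\<alpha> * w1 + ?\<beta> = s" "?\<alpha> * w2 + ?\<beta> * m = t"
      using \<Delta> by (simp_all add: divide_simps) (simp_all add: \<Delta>_def algebra_simps)
    have e': "?\<alpha> * w1 - ?\<beta> = a * s + b * t" "?\<alpha> * w2 - ?\<beta> * m = c * s + (- a) * t"
      unfolding d[symmetric] unfolding a_def b_def c_def
      using \<Delta> by (simp_all add: divide_simps) (simp_all add: \<Delta>_def algebra_simps)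
    have "(a * s + b * t) *\<^sub>R p + (c * s + - a * t) *\<^sub>R q = ?\<alpha> *\<^sub>R w - ?\<beta> *\<^sub>R (p + m *\<^sub>R q)"
      unfolding e'[symmetric] w
      by (simp only: scaleR_add_left scaleR_diff_left scaleR_add_right scaleR_scaleR) simp
    moreover have "s *\<^sub>R p + t *\<^sub>R q = ?\<alpha> *\<^sub>R w + ?\<beta> *\<^sub>R (p + m *\<^sub>R q)"
      unfolding w
      by (subst e(1)[symmetric], subst e(2)[symmetric],
          simp only: scaleR_add_left scaleR_add_right scaleR_scaleR) simp
    ultimately show "norm ((a * s + b * t) *\<^sub>R p + (c * s + - a * t) *\<^sub>R q) = norm (s *\<^sub>R p + t *\<^sub>R q)"
      using refl by simp
  qed
  moreover have bm: "a + b * m = -1" and cm: "c - a * m = - m"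
    unfolding a_def b_def c_def using \<Delta> by (simp_all add: field_simps) (simp_all add: \<Delta>_def algebra_simps)
  moreover have "a * a + b * c = 1"
  proof -
    have c: "c = a * m - m" using cm by simp
    have "a * a + b * c = a * a + (b * m) * (a - 1)" unfolding c by (simp add: algebra_simps)
    also have "b * m = -1 - a" using bm by simp
    finally show ?thesis by (simp add: algebra_simps)
  qed
  ultimately show ?thesis using that by blast
qed

text \<open>Otherwise \<open>n * norm u \<le> 2 * norm v\<close> fails for large \<open>n\<close>.
  This excludes shears among the isometries.\<close>

lemma norm_bounded_translation:
  fixes u v :: "'a::real_normed_vector"
  assumes "\<And>n::nat. norm (v + real n *\<^sub>R u) = norm v"
  shows "u = 0"
proof (rule ccontr)
  assume "u \<noteq> 0"
  then obtain n :: nat where "real n * norm u > 2 * norm v"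
    using reals_Archimedean3[of "norm u"] by auto
  moreover have "real n * norm u \<le> norm (v + real n *\<^sub>R u) + norm v"
    using norm_triangle_ineq4[of "v + real n *\<^sub>R u" v] by simp
  ultimately show False using assms[of n] by simp
qed

text \<open>Since \<open>b * c = 1 - a * a\<close>, the claim is \<open>\<bar>a\<bar> < 1\<close>.
  The product of the two reflections has determinant 1 and trace \<open>2 * a\<close>, so
  \<open>\<bar>a\<bar> \<le> 1\<close>; for \<open>a = 1\<close> or \<open>a = -1\<close> it would
  be a nontrivial shear up to sign.\<close>

lemma reflection_matrix_nondegenerate:
  assumes B: "plane_basis p q"
    and D: "coord_isometry p q 1 0 0 (-1)"
    and R: "coord_isometry p q a b c (- a)" "a * a + b * c = 1"
      "a + b * m = -1" "c - a * m = - m" and "m \<noteq> 0"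
  shows "b * c > 0"
proof -
  have p: "p \<noteq> 0" and q: "q \<noteq> 0" using plane_basis_nonzero[OF B] by auto
  have DR: "coord_isometry p q a b (- c) a" using coord_isometry_comp[OF D R(1)] by simp
  then have "\<bar>a + a\<bar> \<le> 2" by (rule coord_isometry_trace_le) (use R p in auto)
  then have a1: "\<bar>a\<bar> \<le> 1" by simp
  have "a \<noteq> 1"
  proof
    assume a: "a = 1"
    then have "c = 0" "b \<noteq> 0" using R by auto
    have "norm (q + real n *\<^sub>R (b *\<^sub>R p)) = norm q" for n
    proof (induction n)
      case (Suc n)
      have "norm (q + real (Suc n) *\<^sub>R (b *\<^sub>R p)) = norm ((real n * b + b) *\<^sub>R p + q)"
        by (simp add: algebra_simps)
      then show ?case
        using coord_isometryD[OF DR, of "real n * b" 1] a \<open>c = 0\<close> Suc by (simp add: add.commute)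
    qed simp
    then show False using norm_bounded_translation[of q "b *\<^sub>R p"] \<open>b \<noteq> 0\<close> p by simp
  qed
  moreover have "a \<noteq> -1"
  proof
    assume a: "a = -1"
    then have "b = 0" "c \<noteq> 0" using R \<open>m \<noteq> 0\<close> by auto
    have "norm (p + real n *\<^sub>R (c *\<^sub>R q)) = norm p" for n
    proof (induction n)
      case (Suc n)
      \<comment> \<open>Here the product is the negative of a shear, hence the change of sign in
        each iteration.\<close>
      have "norm (p + real (Suc n) *\<^sub>R (c *\<^sub>R q)) = norm (- (p + real (Suc n) *\<^sub>R (c *\<^sub>R q)))"
        by (rule norm_minus_cancel[symmetric])
      also have "- (p + real (Suc n) *\<^sub>R (c *\<^sub>R q)) = (-1) *\<^sub>R p + (- c - real n * c) *\<^sub>R q"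
        by (simp add: algebra_simps)
      finally show ?case
        using coord_isometryD[OF DR, of 1 "real n * c"] a \<open>b = 0\<close> Suc by simp
    qed simp
    then show False using norm_bounded_translation[of p "c *\<^sub>R q"] \<open>c \<noteq> 0\<close> q by simp
  qed
  ultimately have "\<bar>a\<bar> < 1" using a1 by linarith
  then have "a\<^sup>2 < 1" by (simp add: abs_square_less_1)
  then show ?thesis using R(2) by (simp add: power2_eq_square)
qed

text \<open>One reflection off the axes fixes \<open>\<kappa>\<close>, and the trace condition makes
  every other available reflection preserve \<open>s^2 + \<kappa> * t^2\<close>. The images of
  \<open>p\<close> are dense in an ellipse of that form, on which the norm is then constant;
  homogeneity gives the whole plane.\<close>

lemma norm_diagonal_of_reflections:
  assumes B: "plane_basis p q"
    and D: "coord_isometry p q 1 0 0 (-1)"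
    and S: "countable S"
    and R: "\<And>m. m \<notin> S \<Longrightarrow> \<exists>a b c. coord_isometry p q a b c (- a) \<and> a * a + b * c = 1 \<and>
      a + b * m = -1 \<and> c - a * m = - m"
  obtains \<kappa> where "\<kappa> > 0" "\<And>s t. norm (s *\<^sub>R p + t *\<^sub>R q) = sqrt (s\<^sup>2 + \<kappa> * t\<^sup>2) * norm p"
proof -
  have p: "p \<noteq> 0" using plane_basis_nonzero[OF B] by auto
  have "insert 0 S \<noteq> UNIV" using S uncountable_UNIV_real by (metis countable_insert)
  then obtain m0 where m0: "m0 \<notin> S" "m0 \<noteq> 0" by blast
  obtain a0 b0 c0 where R0: "coord_isometry p q a0 b0 c0 (- a0)" "a0 * a0 + b0 * c0 = 1"
      "a0 + b0 * m0 = -1" "c0 - a0 * m0 = - m0" using R[OF m0(1)] by blast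
  have bc: "b0 * c0 > 0" by (rule reflection_matrix_nondegenerate[OF B D R0 m0(2)])
  define \<kappa> where "\<kappa> = b0 / c0"
  have \<kappa>: "\<kappa> > 0" using bc by (auto simp: \<kappa>_def zero_less_mult_iff zero_less_divide_iff)
  have eq: "norm ((\<kappa> * m\<^sup>2 - 1) *\<^sub>R p + (- 2 * m) *\<^sub>R q) = (1 + \<kappa> * m\<^sup>2) * norm p" if mS: "m \<notin> S" for m
  proof -
    obtain a b c where R': "coord_isometry p q a b c (- a)" "a * a + b * c = 1"
      "a + b * m = -1" "c - a * m = - m" using R[OF mS] by blast
    have DR: "coord_isometry p q a b (- c) a" using coord_isometry_comp[OF D R'(1)] by simp
    \<comment> \<open>The product of three reflections has determinant -1; the vanishing of its
      trace reads \<open>c0 * b = b0 * c\<close>.\<close>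
    have "(a0 * a + b0 * (- c)) * (c0 * b + (- a0) * a) - (a0 * b + b0 * a) * (c0 * a + (- a0) * (- c))
        = - ((a0 * a0 + b0 * c0) * (a * a + b * c))"
      by (simp add: algebra_simps)
    then have "(a0 * a + b0 * (- c)) + (c0 * b + (- a0) * a) = 0"
      by (intro coord_isometry_trace_zero[OF coord_isometry_comp[OF R0(1) DR] _ p]) (simp add: R0(2) R'(2))
    then have "c0 * b = b0 * c" by simp
    then have "b * c0 = b0 * c" by (simp add: mult.commute)
    moreover have "c0 \<noteq> 0" using bc by auto
    ultimately have b: "b = \<kappa> * c" by (simp add: \<kappa>_def eq_divide_eq)
    have c: "c = (a - 1) * m" using R'(4) by (simp add: algebra_simps)
    have a': "(1 + \<kappa> * m\<^sup>2) * a = \<kappa> * m\<^sup>2 - 1"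
      using R'(3) unfolding b c by (simp add: algebra_simps power2_eq_square)
    have "(1 + \<kappa> * m\<^sup>2) * c = ((1 + \<kappa> * m\<^sup>2) * a - (1 + \<kappa> * m\<^sup>2)) * m"
      unfolding c by (simp add: algebra_simps)
    then have c': "(1 + \<kappa> * m\<^sup>2) * c = - 2 * m" unfolding a' by (simp add: algebra_simps)
    have pos: "1 + \<kappa> * m\<^sup>2 > 0" using \<kappa> by (simp add: add_pos_nonneg)
    have "(\<kappa> * m\<^sup>2 - 1) *\<^sub>R p + (- 2 * m) *\<^sub>R q = (1 + \<kappa> * m\<^sup>2) *\<^sub>R (a *\<^sub>R p + c *\<^sub>R q)"
      unfolding a'[symmetric] c'[symmetric] by (simp only: scaleR_add_right scaleR_scaleR)
    moreover have "norm (a *\<^sub>R p + c *\<^sub>R q) = norm p" using coord_isometryD[OF R'(1), of 1 0] by simp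
    ultimately show ?thesis using pos by simp
  qed
  let ?f = "\<lambda>m. norm ((\<kappa> * m\<^sup>2 - 1) *\<^sub>R p + (- 2 * m) *\<^sub>R q)" and ?g = "\<lambda>m. (1 + \<kappa> * m\<^sup>2) * norm p"
  \<comment> \<open>The exceptional set is open by continuity and lies in \<open>S\<close>; a
    countable open set of reals is empty.\<close>
  have "open {m. ?f m \<noteq> ?g m}" by (intro open_Collect_neq continuous_intros)
  moreover have "countable {m. ?f m \<noteq> ?g m}" using eq by (intro countable_subset[OF _ S]) blast
  ultimately have all: "?f m = ?g m" for m
    using open_minus_countable[of "{m. ?f m \<noteq> ?g m}" "{m. ?f m \<noteq> ?g m}"] by blast
  have "norm (s *\<^sub>R p + t *\<^sub>R q) = sqrt (s\<^sup>2 + \<kappa> * t\<^sup>2) * norm p" for s t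
  proof (cases "t = 0")
    case False
    define \<rho> where "\<rho> = sqrt (s\<^sup>2 + \<kappa> * t\<^sup>2)"
    have \<rho>2: "\<rho>\<^sup>2 = s\<^sup>2 + \<kappa> * t\<^sup>2" using \<kappa> by (simp add: \<rho>_def)
    have "sqrt (s\<^sup>2) < \<rho>" unfolding \<rho>_def using \<kappa> False by (intro real_sqrt_less_mono) simp
    then have \<rho>s: "\<rho> + s > 0" by simp
    \<comment> \<open>This is the slope for which the image of \<open>p\<close> points along
      \<open>s p + t q\<close>, as in stereographic projection. Of the two roots of
      \<open>\<kappa> * t * m^2 + 2 * s * m = t\<close> it is the one with a positive factor
      \<open>C\<close>.\<close>
    define m where "m = - (\<rho> + s) / (\<kappa> * t)"
    define C where "C = 2 * (\<rho> + s) / (\<kappa> * t\<^sup>2)"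
    have C: "C > 0" using \<rho>s \<kappa> False by (simp add: C_def)
    have km: "\<kappa> * m\<^sup>2 = (\<rho> + s)\<^sup>2 / (\<kappa> * t\<^sup>2)"
      using \<kappa> False by (simp add: m_def power_divide field_simps power2_eq_square)
    have e1: "\<kappa> * m\<^sup>2 - 1 = C * s" "1 + \<kappa> * m\<^sup>2 = C * \<rho>"
      unfolding km C_def using \<kappa> False \<rho>2 by (simp_all add: field_simps power2_eq_square)
    have e2: "- 2 * m = C * t" unfolding m_def C_def using \<kappa> False by (simp add: field_simps power2_eq_square)
    have "norm ((C * s) *\<^sub>R p + (C * t) *\<^sub>R q) = C * \<rho> * norm p"
      using all[of m] unfolding e1 e2 .
    moreover have "(C * s) *\<^sub>R p + (C * t) *\<^sub>R q = C *\<^sub>R (s *\<^sub>R p + t *\<^sub>R q)" by (simp add: scaleR_add_right)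
    ultimately show ?thesis using C unfolding \<rho>_def[symmetric] by simp
  qed simp
  then show ?thesis using that \<kappa> by blast
qed

section \<open>Recovering the inner product\<close>

text \<open>The form comes from polarization; in coordinates it is
  \<open>(s * s' + \<kappa> * t * t')\<close> times the square of \<open>norm p\<close>, which makes
  bilinearity visible.\<close>

lemma norm_is_euclidean_of_diagonal:
  fixes p q :: "'a::real_normed_vector"
  assumes B: "plane_basis p q" and \<kappa>: "\<kappa> > 0"
    and N: "\<And>s t. norm (s *\<^sub>R p + t *\<^sub>R q) = sqrt (s\<^sup>2 + \<kappa> * t\<^sup>2) * norm p"
  shows "norm_is_euclidean TYPE('a)"
proof -
  define ip where "ip x y = ((norm (x + y))\<^sup>2 - (norm (x - y))\<^sup>2) / 4" for x y :: 'a
  have N2: "(norm (s *\<^sub>R p + t *\<^sub>R q))\<^sup>2 = (s\<^sup>2 + \<kappa> * t\<^sup>2) * (norm p)\<^sup>2" for s t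
    unfolding N using \<kappa> by (simp add: power_mult_distrib)
  have ip: "ip (s *\<^sub>R p + t *\<^sub>R q) (s' *\<^sub>R p + t' *\<^sub>R q) = (s * s' + \<kappa> * t * t') * (norm p)\<^sup>2" for s t s' t'
  proof -
    have e: "(s *\<^sub>R p + t *\<^sub>R q) + (s' *\<^sub>R p + t' *\<^sub>R q) = (s + s') *\<^sub>R p + (t + t') *\<^sub>R q"
      "(s *\<^sub>R p + t *\<^sub>R q) - (s' *\<^sub>R p + t' *\<^sub>R q) = (s - s') *\<^sub>R p + (t - t') *\<^sub>R q"
      by (simp_all add: algebra_simps)
    show ?thesis unfolding ip_def e N2 by (simp add: algebra_simps power2_eq_square)
  qed
  have comm: "ip x y = ip y x" for x y
    by (simp add: ip_def norm_minus_commute add.commute)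
  have add: "ip x (y + z) = ip x y + ip x z" for x y z
  proof -
    obtain s t where x: "x = s *\<^sub>R p + t *\<^sub>R q" using plane_basis_ex[OF B] .
    obtain s1 t1 where y: "y = s1 *\<^sub>R p + t1 *\<^sub>R q" using plane_basis_ex[OF B] .
    obtain s2 t2 where z: "z = s2 *\<^sub>R p + t2 *\<^sub>R q" using plane_basis_ex[OF B] .
    have yz: "y + z = (s1 + s2) *\<^sub>R p + (t1 + t2) *\<^sub>R q" by (simp add: y z algebra_simps)
    show ?thesis unfolding yz unfolding x y z ip by (simp add: algebra_simps)
  qed
  have scale: "ip x (r *\<^sub>R y) = r *\<^sub>R ip x y" for x y r
  proof -
    obtain s t where x: "x = s *\<^sub>R p + t *\<^sub>R q" using plane_basis_ex[OF B] .
    obtain s1 t1 where y: "y = s1 *\<^sub>R p + t1 *\<^sub>R q" using plane_basis_ex[OF B] .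
    have ry: "r *\<^sub>R y = (r * s1) *\<^sub>R p + (r * t1) *\<^sub>R q" by (simp add: y scaleR_add_right)
    show ?thesis unfolding ry unfolding x y ip by (simp add: algebra_simps)
  qed
  have "linear (ip x)" for x by (rule linearI) (simp_all add: add scale)
  moreover have "(\<lambda>x. ip x y) = ip y" for y using comm by blast
  ultimately have "bilinear ip" by (simp add: bilinear_def)
  moreover have "ip x x = (norm x)\<^sup>2" for x
  proof -
    have "x + x = 2 *\<^sub>R x" by (simp add: scaleR_2)
    then show ?thesis by (simp add: ip_def power_mult_distrib)
  qed
  ultimately show ?thesis
    unfolding norm_is_euclidean_def using comm by (intro exI[of _ ip]) simp
qed

lemma norm_is_euclidean_of_scale_invariance:
  fixes p0 q0 :: "'a::real_normed_vector"
  assumes B0: "plane_basis p0 q0"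
    and scale: "\<And>x::'a. x \<noteq> 0 \<Longrightarrow> \<exists>l>0. l \<noteq> 1 \<and>
      (\<forall>z. norm (z + x) = norm (z - x) \<longrightarrow> norm (z + l *\<^sub>R x) = norm (z - l *\<^sub>R x))"
  shows "norm_is_euclidean TYPE('a)"
proof -
  have refl: "\<exists>w. plane_basis x w \<and> (\<forall>a b. norm (a *\<^sub>R w - b *\<^sub>R x) = norm (a *\<^sub>R w + b *\<^sub>R x))"
    if x: "x \<noteq> 0" and nf: "\<And>d. \<not> flat_along x d" for x :: 'a
  proof -
    obtain v where v: "plane_basis x v" using plane_basis_extend[OF B0 x] .
    obtain l where l: "l > 0" "l \<noteq> 1"
      "\<And>z. norm (z + x) = norm (z - x) \<Longrightarrow> norm (z + l *\<^sub>R x) = norm (z - l *\<^sub>R x)"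
      using scale[OF x] by blast
    show ?thesis by (rule reflection_of_scale_invariance[OF v nf l]) blast+
  qed
  have nz: "p + m *\<^sub>R q \<noteq> 0" if "plane_basis p q" for p q :: 'a and m
    using plane_basis_zeroD[OF that, of 1 m] by auto
  have "{m. \<exists>d. flat_along (p0 + m *\<^sub>R q0) d} \<noteq> UNIV"
    using countable_flat_slopes[OF B0] uncountable_UNIV_real by metis
  then obtain m0 where m0: "\<And>d. \<not> flat_along (p0 + m0 *\<^sub>R q0) d" by blast
  \<comment> \<open>A direction without segments serves as \<open>q\<close>, and \<open>p\<close>
    spans the axis of its reflection, so that this reflection has the matrix
    \<open>D\<close>.\<close>
  define q where "q = p0 + m0 *\<^sub>R q0"
  obtain p where p: "plane_basis q p" "\<And>a b. norm (a *\<^sub>R p - b *\<^sub>R q) = norm (a *\<^sub>R p + b *\<^sub>R q)"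
    using refl[OF nz[OF B0] m0] unfolding q_def by blast
  have B: "plane_basis p q" using p(1) by (rule plane_basis_commute)
  have D: "coord_isometry p q 1 0 0 (-1)" using p(2) by (simp add: coord_isometry_def)
  have R: "\<exists>a b c. coord_isometry p q a b c (- a) \<and> a * a + b * c = 1 \<and> a + b * m = -1 \<and> c - a * m = - m"
    if nf: "m \<notin> {m. \<exists>d. flat_along (p + m *\<^sub>R q) d}" for m
  proof -
    obtain w where w: "plane_basis (p + m *\<^sub>R q) w"
      "\<And>a b. norm (a *\<^sub>R w - b *\<^sub>R (p + m *\<^sub>R q)) = norm (a *\<^sub>R w + b *\<^sub>R (p + m *\<^sub>R q))"
      using refl[OF nz[OF B], of m] nf by blast
    show ?thesis by (rule reflection_matrix[OF B w]) blast
  qed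
  obtain \<kappa> where "\<kappa> > 0" "\<And>s t. norm (s *\<^sub>R p + t *\<^sub>R q) = sqrt (s\<^sup>2 + \<kappa> * t\<^sup>2) * norm p"
    using norm_diagonal_of_reflections[OF B D countable_flat_slopes[OF B] R] by blast
  then show ?thesis by (rule norm_is_euclidean_of_diagonal[OF B])
qed

section \<open>The Euclidean case and the equivalence\<close>

text \<open>For an inner product the bisector of \<open>- v\<close> and \<open>v\<close> consists of
  vectors orthogonal to \<open>v\<close>. A common point is orthogonal to the span of
  \<open>x\<close> and \<open>y\<close>, hence to itself.\<close>

lemma euclidean_bisectors_meet_trivially:
  fixes x y :: "'a::real_normed_vector"
  assumes "norm_is_euclidean TYPE('a)" and sp: "span {x, y} = UNIV"
  shows "bisector (- x) x \<inter> bisector (- y) y = {0}"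
proof -
  obtain ip :: "'a \<Rightarrow> 'a \<Rightarrow> real" where bil: "bilinear ip" and comm: "\<And>x y. ip x y = ip y x"
    and pos: "\<And>x. x \<noteq> 0 \<Longrightarrow> ip x x > 0" and N: "\<And>x. norm x = sqrt (ip x x)"
    using assms(1) unfolding norm_is_euclidean_def by blast
  have orth: "ip z v = 0" if "z \<in> bisector (- v) v" for z v
  proof -
    have "ip (z + v) (z + v) = ip (z - v) (z - v)"
      using that unfolding mem_bisector_minus_iff N by simp
    then show ?thesis
      using comm[of v z]
      by (simp add: bilinear_ladd[OF bil] bilinear_radd[OF bil] bilinear_lsub[OF bil] bilinear_rsub[OF bil])
  qed
  have "z = 0" if z: "z \<in> bisector (- x) x" "z \<in> bisector (- y) y" for z
  proof -
    have lin: "linear (ip z)" using bil by (simp add: bilinear_def)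
    have "ip z v = 0" if "v \<in> {x, y}" for v using orth z that by auto
    then have "ip z z = 0" using linear_eq_0_on_span[OF lin, of "{x, y}" z] sp by blast
    then show ?thesis using pos[of z] by fastforce
  qed
  moreover have "0 \<in> bisector (- x) x \<inter> bisector (- y) y" by (simp add: mem_bisector_minus_iff)
  ultimately show ?thesis by blast
qed

theorem theorem3p2:
  assumes "dim (UNIV :: ('a::real_normed_vector) set) = 2"
  shows "\<not> norm_is_euclidean TYPE('a) \<longleftrightarrow>
    (\<exists>x::'a. x \<noteq> 0 \<and>
      (\<forall>l::real. l > 0 \<and> l \<noteq> 1 \<longrightarrow>
        (\<exists>y::'a. norm y = l * norm x \<and> span {x, y} = UNIV \<and>
           bisector (-x) x \<inter> bisector (-y) y \<noteq> {0})))"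
  (is "?L \<longleftrightarrow> ?R")
proof
  assume ?R
  then obtain x :: 'a where x: "\<And>l::real. l > 0 \<and> l \<noteq> 1 \<Longrightarrow>
      \<exists>y. norm y = l * norm x \<and> span {x, y} = UNIV \<and> bisector (- x) x \<inter> bisector (- y) y \<noteq> {0}"
    by blast
  \<comment> \<open>A single scale different from 1 already contradicts the Euclidean case; 2 is
    taken.\<close>
  show ?L using x[of 2] euclidean_bisectors_meet_trivially by force
next
  assume L: ?L
  obtain p q :: 'a where B: "plane_basis p q" using plane_basis_of_dim[OF assms] .
  show ?R
  proof (rule ccontr)
    assume nR: "\<not> ?R"
    have "norm_is_euclidean TYPE('a)"
    proof (rule norm_is_euclidean_of_scale_invariance[OF B])
      fix x :: 'a assume x: "x \<noteq> 0"
      obtain v where v: "plane_basis x v" using plane_basis_extend[OF B x] .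
      \<comment> \<open>Negating the condition at \<open>x\<close> yields a scale at which all
        independent \<open>y\<close> have trivial intersection.\<close>
      obtain l :: real where l: "l > 0" "l \<noteq> 1" and triv: "\<And>y. norm y = l * norm x \<Longrightarrow>
          span {x, y} = UNIV \<Longrightarrow> bisector (- x) x \<inter> bisector (- y) y = {0}"
        using nR x by blast
      show "\<exists>l>0. l \<noteq> 1 \<and>
          (\<forall>z. norm (z + x) = norm (z - x) \<longrightarrow> norm (z + l *\<^sub>R x) = norm (z - l *\<^sub>R x))"
        using l isosceles_orthogonal_scale[OF v l(1) triv] by blast
    qed
    then show False using L by simp
  qed
qed

end
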